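(* Let $\theta$ be an inner function, let $\theta_0$ be its $0$-th Fourier coefficient, and let $\phi\in L^\infty$. Then the dual truncated Hankel operator $\mathcal{H}_\phi^\theta$ satisfies $$\mathcal{H}_\phi^\theta U_\theta^*-U_\theta\mathcal{H}_\phi^\theta=\theta\otimes Q_\theta J(\alpha_{\phi^*})-Q_\theta J(\alpha_\phi)\otimes\theta,$$ where $\alpha_\phi=\phi\bar z(\theta-\theta_0)$ and $\alpha_{\phi^*}=\phi^*\bar z(\theta-\theta_0)$.
   Context: $\mathbb{T}$ is the unit circle with normalized Lebesgue measure, $L^2=L^2(\mathbb{T})$ with inner product $\langle\cdot,\cdot\rangle$ linear in the first entry, $L^\infty=L^\infty(\mathbb{T})$. $H^2\subset L^2$ is the Hardy space (functions whose negative Fourier coefficients vanish), $H_0^2=zH^2$, $\overline{H_0^2}=L^2\ominus H^2$. $P:L^2\to H^2$ is the orthogonal projection and $Q=I-P$ is the orthogonal projection onto $\overline{H_0^2}$. The flip $J$ on $L^2$ is $(Jf)(z)=f(\bar z)$, $z\in\mathbb{T}$. For an inner function $\theta$ (bounded analytic on the disk, unimodular a.e. on $\mathbb{T}$), $K_\theta=H^2\ominus\theta H^2$ and $K_\theta^\perp=L^2\ominus K_\theta=\overline{H_0^2}\oplus\theta H^2$; $Q_\theta=Q+\theta P\bar\theta$ is the orthogonal projection of $L^2$ onto $K_\theta^\perp$. For $\phi\in L^\infty$ the dual truncated Hankel operator is $\mathcal{H}_\phi^\theta:K_\theta^\perp\to K_\theta^\perp$, $\mathcal{H}_\phi^\theta(h)=Q_\theta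 J(\phi h)$. The compressed shift on $K_\theta^\perp$ is $U_\theta h=Q_\theta(zh)$. For $f,g$ in a Hilbert space, $f\otimes g$ is the operator $h\mapsto\langle h,g\rangle f$. For $\phi\in L^2$, $\phi^*(z)=\overline{\phi(\bar z)}$ on $\mathbb{T}$. *)

theory Defs
  imports "HOL-Probability.Probability" "HOL-Complex_Analysis.Complex_Analysis"
begin

text \<open>
  Elements of \<open>L\<^sup>2\<close> and \<open>L\<^sup>\<infinity>\<close> of the circle are represented by functions rather than by
  equivalence classes, so identities between them are to be read almost everywhere with
  respect to \<open>circle\<close>. The sets of functions below are closed under almost everywhere
  equality of measurable functions.
\<close>

definition circle :: "complex measure" where
  "circle = distr (uniform_measure lborel {0..<2 * pi}) (restrict_space borel (sphere 0 1)) cis"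

definition L2 :: "(complex \<Rightarrow> complex) set" where
  "L2 = {f \<in> borel_measurable circle. integrable circle (\<lambda>z. (cmod (f z))\<^sup>2)}"

definition Linf :: "(complex \<Rightarrow> complex) set" where
  "Linf = {f \<in> borel_measurable circle. \<exists>C. AE z in circle. cmod (f z) \<le> C}"

definition ip :: "(complex \<Rightarrow> complex) \<Rightarrow> (complex \<Rightarrow> complex) \<Rightarrow> complex" where
  "ip f g = (LINT z|circle. f z * cnj (g z))"

definition fourier_coeff :: "(complex \<Rightarrow> complex) \<Rightarrow> int \<Rightarrow> complex" where
  "fourier_coeff f n = ip f (\<lambda>z. z powi n)"

definition H2 :: "(complex \<Rightarrow> complex) set" where
  "H2 = {f \<in> L2. \<forall>n<0. fourier_coeff f n = 0}"

definition ominus ::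
  "(complex \<Rightarrow> complex) set \<Rightarrow> (complex \<Rightarrow> complex) set \<Rightarrow> (complex \<Rightarrow> complex) set"
  (infixl "\<ominus>" 65) where
  "A \<ominus> B = {f \<in> A. \<forall>g\<in>B. ip f g = 0}"

text \<open>
  The projection of \<open>f\<close> onto a closed subspace and the value of an adjoint operator are
  unique only up to almost everywhere equality, hence the choice operator in the next
  definition and in \<open>adjoint_on\<close>.
\<close>

definition orth_proj ::
  "(complex \<Rightarrow> complex) set \<Rightarrow> (complex \<Rightarrow> complex) \<Rightarrow> (complex \<Rightarrow> complex)" where
  "orth_proj S f = (SOME g. g \<in> S \<and> (\<forall>k\<in>S. ip (f - g) k = 0))"

definition adjoint_on ::
  "(complex \<Rightarrow> complex) set \<Rightarrow> ((complex \<Rightarrow> complex) \<Rightarrow> (complex \<Rightarrow> complex))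
    \<Rightarrow> (complex \<Rightarrow> complex) \<Rightarrow> (complex \<Rightarrow> complex)" where
  "adjoint_on S T k = (SOME g. g \<in> S \<and> (\<forall>h\<in>S. ip (T h) k = ip h g))"

definition rank_one ::
  "(complex \<Rightarrow> complex) \<Rightarrow> (complex \<Rightarrow> complex) \<Rightarrow> (complex \<Rightarrow> complex) \<Rightarrow> (complex \<Rightarrow> complex)"
  (infix "\<otimes>\<^sub>r" 70) where
  "(f \<otimes>\<^sub>r g) h = (\<lambda>z. ip h g * f z)"

definition P :: "(complex \<Rightarrow> complex) \<Rightarrow> (complex \<Rightarrow> complex)" where
  "P = orth_proj H2"

definition Q :: "(complex \<Rightarrow> complex) \<Rightarrow> (complex \<Rightarrow> complex)" where
  "Q f = f - P f"

definition J :: "(complex \<Rightarrow> complex) \<Rightarrow> (complex \<Rightarrow> complex)" where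
  "J f = (\<lambda>z. f (cnj z))"

definition star :: "(complex \<Rightarrow> complex) \<Rightarrow> (complex \<Rightarrow> complex)" where
  "star \<phi> = (\<lambda>z. cnj (\<phi> (cnj z)))"

text \<open>
  An inner function is represented by its boundary function \<open>\<theta>\<close> on the circle, given
  almost everywhere by the radial limits of a bounded analytic function \<open>F\<close> on the disk.
\<close>

definition inner_function :: "(complex \<Rightarrow> complex) \<Rightarrow> bool" where
  "inner_function \<theta> \<longleftrightarrow>
     \<theta> \<in> borel_measurable circle \<and>
     (\<exists>F. F holomorphic_on ball 0 1 \<and> bounded (F ` ball 0 1) \<and>
        (AE z in circle. ((\<lambda>r. F (complex_of_real r * z)) \<longlongrightarrow> \<theta> z) (at_left 1))) \<and>
     (AE z in circle. cmod (\<theta> z) = 1)"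

definition K :: "(complex \<Rightarrow> complex) \<Rightarrow> (complex \<Rightarrow> complex) set" where
  "K \<theta> = H2 \<ominus> {\<lambda>z. \<theta> z * g z |g. g \<in> H2}"

definition Kperp :: "(complex \<Rightarrow> complex) \<Rightarrow> (complex \<Rightarrow> complex) set" where
  "Kperp \<theta> = L2 \<ominus> K \<theta>"

definition Qt :: "(complex \<Rightarrow> complex) \<Rightarrow> (complex \<Rightarrow> complex) \<Rightarrow> (complex \<Rightarrow> complex)" where
  "Qt \<theta> f = (\<lambda>z. Q f z + \<theta> z * P (\<lambda>w. cnj (\<theta> w) * f w) z)"

definition dual_hankel ::
  "(complex \<Rightarrow> complex) \<Rightarrow> (complex \<Rightarrow> complex) \<Rightarrow> (complex \<Rightarrow> complex) \<Rightarrow> (complex \<Rightarrow> complex)" where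
  "dual_hankel \<theta> \<phi> h = Qt \<theta> (J (\<lambda>z. \<phi> z * h z))"

definition U :: "(complex \<Rightarrow> complex) \<Rightarrow> (complex \<Rightarrow> complex) \<Rightarrow> (complex \<Rightarrow> complex)" where
  "U \<theta> h = Qt \<theta> (\<lambda>z. z * h z)"

definition \<alpha> :: "(complex \<Rightarrow> complex) \<Rightarrow> (complex \<Rightarrow> complex) \<Rightarrow> (complex \<Rightarrow> complex)" where
  "\<alpha> \<theta> \<phi> = (\<lambda>z. \<phi> z * cnj z * (\<theta> z - fourier_coeff \<theta> 0))"

end

theory Submission
  imports Defs
begin

text \<open>
  Let \<open>w = cnj z * (\<theta> - \<theta>\<^sub>0)\<close> be the backward shift of \<open>\<theta>\<close>, so that \<open>\<alpha> \<theta> \<phi> = \<phi> * w\<close>. The identity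
  rests on the way the shift couples \<open>K \<theta>\<close> to its complement. The function \<open>w\<close> lies in \<open>K \<theta>\<close>
  (\<open>backward_shift_theta_K\<close>), and for \<open>k\<close> in \<open>K \<theta>\<close> the part of \<open>z * k\<close> outside \<open>K \<theta>\<close> is one-dimensional:
  \<open>Qt \<theta> (z * k) = ip k w * \<theta>\<close> (\<open>Qt_shift_K\<close>). Dually, for \<open>h\<close> in \<open>Kperp \<theta>\<close> the part of \<open>cnj z * h\<close> in \<open>K \<theta>\<close> is
  \<open>ip h \<theta> * w\<close>, so the adjoint of \<open>U \<theta>\<close> maps \<open>h\<close> to \<open>cnj z * h - ip h \<theta> * w\<close> (\<open>adjoint_U\<close>).

  Now put \<open>f = J (\<phi> * h)\<close>. Since \<open>J\<close> turns multiplication by \<open>cnj z\<close> into multiplication by \<open>z\<close>, the dual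
  Hankel operator applied to the adjoint gives \<open>Qt (z * f) - ip h \<theta> * Qt (J (\<phi> * w))\<close>. In the other order
  one gets \<open>Qt (z * Qt f) = Qt (z * f) - Qt (z * (f - Qt f))\<close>, and \<open>f - Qt f\<close> is in \<open>K \<theta>\<close>, so the last term is
  \<open>ip (f - Qt f) w * \<theta>\<close>. The terms \<open>Qt (z * f)\<close> cancel. Finally
  \<open>ip (f - Qt f) w = ip f w = ip h (J (star \<phi> * w))\<close>, and \<open>Qt\<close> may be put in front of the last argument since \<open>h\<close> is
  in \<open>Kperp \<theta>\<close>.

  Two analytic facts are behind this. Projections onto \<open>H2\<close> exist (\<open>projection_exists\<close>), which needs the
  completeness of \<open>L2\<close>; otherwise the choices that specify \<open>P\<close> would carry no information. And
  multiplication by the inner function \<open>\<theta>\<close> maps \<open>H2\<close> to itself (\<open>inner_function_mult_H2\<close>), where the analytic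
  extension of \<open>\<theta>\<close> to the disk enters.
\<close>

section \<open>Normalized Lebesgue measure on the circle\<close>

lemma cis_measurable [measurable]: "cis \<in> measurable borel (restrict_space borel (sphere 0 1))"
  by (rule measurable_restrict_space2)
     (auto intro!: borel_measurable_continuous_onI continuous_intros)

lemma sets_circle [measurable_cong, simp]:
  "sets circle = sets (restrict_space borel (sphere 0 1))"
  by (simp add: circle_def)

lemma space_circle [simp]: "space circle = sphere 0 1"
  by (simp add: circle_def space_restrict_space)

lemma prob_space_circle: "prob_space circle"
  unfolding circle_def
  by (intro prob_space.prob_space_distr prob_space_uniform_measure) auto

interpretation circle: prob_space circle
  by (rule prob_space_circle)

lemma borel_measurable_circle_id [measurable]: "(\<lambda>z. z) \<in> borel_measurable circle"
  by (subst measurable_cong_sets[OF sets_circle refl]) (rule measurable_restrict_space1, simp)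

lemma borel_measurable_cnj [measurable]: "cnj \<in> borel_measurable borel"
  by (intro borel_measurable_continuous_onI continuous_intros)

lemma cnj_measurable_circle [measurable]: "cnj \<in> measurable circle circle"
proof (subst measurable_cong_sets[OF refl sets_circle], rule measurable_restrict_space2)
  show "cnj \<in> borel_measurable circle"
    using measurable_compose[OF borel_measurable_circle_id borel_measurable_cnj] by simp
qed auto

text \<open>
  Passing to the angle makes the translations and reflections of the line available.
\<close>

lemma nn_integral_circle:
  assumes [measurable]: "f \<in> borel_measurable circle"
  shows "(\<integral>\<^sup>+z. f z \<partial>circle) =
    (\<integral>\<^sup>+t. f (cis t) * indicator {0..<2*pi} t \<partial>lborel) / ennreal (2*pi)"
proof -
  have f': "f \<in> borel_measurable (restrict_space borel (sphere 0 1))"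
    using assms by (subst measurable_cong_sets[OF sets_circle[symmetric] refl])
  have g: "(\<lambda>t. f (cis t)) \<in> borel_measurable borel"
    by (rule measurable_compose[OF cis_measurable f'])
  have "(\<integral>\<^sup>+z. f z \<partial>circle) = (\<integral>\<^sup>+t. f (cis t) \<partial>uniform_measure lborel {0..<2*pi})"
    unfolding circle_def using f' by (intro nn_integral_distr) auto
  also have "\<dots> = (\<integral>\<^sup>+t. f (cis t) * indicator {0..<2*pi} t \<partial>lborel) / emeasure lborel {0..<2*pi}"
    using g by (intro nn_integral_uniform_measure) auto
  finally show ?thesis by simp
qed

text \<open>
  In the angle, conjugation is the reflection \<open>t \<mapsto> 2 * pi - t\<close>, which preserves Lebesgue measure and
  maps \<open>{0..<2 * pi}\<close> to \<open>{0<..2 * pi}\<close>; the two intervals differ by a null set.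
\<close>

lemma circle_distr_cnj: "distr circle circle cnj = circle"
proof (rule measure_eqI)
  fix A assume A: "A \<in> sets (distr circle circle cnj)"
  then have A' [measurable]: "A \<in> sets circle" by simp
  define f :: "complex \<Rightarrow> ennreal" where "f = indicator A"
  have fm [measurable]: "f \<in> borel_measurable circle" unfolding f_def by measurable
  have g [measurable]: "(\<lambda>t. f (cis t)) \<in> borel_measurable borel"
    by (rule measurable_compose[OF cis_measurable])
       (use fm in \<open>subst measurable_cong_sets[OF sets_circle[symmetric] refl]\<close>)
  have "emeasure (distr circle circle cnj) A = (\<integral>\<^sup>+z. f z \<partial>distr circle circle cnj)"
    unfolding f_def by (rule nn_integral_indicator[OF A, symmetric])
  also have "\<dots> = (\<integral>\<^sup>+z. f (cnj z) \<partial>circle)"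
    by (rule nn_integral_distr) auto
  also have "\<dots> = (\<integral>\<^sup>+t. f (cis (-t)) * indicator {0..<2*pi} t \<partial>lborel) / ennreal (2*pi)"
    by (subst nn_integral_circle) (auto simp: cis_cnj)
  also have "(\<integral>\<^sup>+t. f (cis (-t)) * indicator {0..<2*pi} t \<partial>lborel) =
     (\<integral>\<^sup>+t. f (cis t) * indicator {0..<2*pi} t \<partial>lborel)"
  proof -
    have [measurable]: "(\<lambda>t. f (cis (-t))) \<in> borel_measurable borel"
      using measurable_compose[OF _ g, of uminus] by simp
    have "(\<integral>\<^sup>+t. f (cis (-t)) * indicator {0..<2*pi} t \<partial>lborel) =
       (\<integral>\<^sup>+t. f (cis (-(2*pi + (-1) * t))) * indicator {0..<2*pi} (2*pi + (-1) * t) \<partial>lborel)"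
      by (subst nn_integral_real_affine[where c="-1" and t="2*pi"]) auto
    also have "\<dots> = (\<integral>\<^sup>+t. f (cis t) * indicator {0..<2*pi} t \<partial>lborel)"
    proof (rule nn_integral_cong_AE)
      have "AE t in lborel. t \<noteq> (0::real)" "AE t in lborel. t \<noteq> (2*pi::real)"
        by (rule AE_lborel_singleton)+
      then show "AE t in lborel. f (cis (-(2*pi + (-1) * t))) * indicator {0..<2*pi} (2*pi + (-1) * t)
          = f (cis t) * indicator {0..<2*pi} t"
      proof eventually_elim
        case (elim t)
        have "cis (t - 2*pi) = cis t"
          using cis_divide[of t "2*pi"] by simp
        then show ?case using elim by (auto simp: indicator_def)
      qed
    qed
    finally show ?thesis .
  qed
  also have "\<dots> / ennreal (2*pi) = emeasure circle A"
    by (subst nn_integral_circle[symmetric]) (use A' in \<open>auto simp: f_def\<close>)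
  finally show "emeasure (distr circle circle cnj) A = emeasure circle A" .
qed simp

lemma integral_circle_cnj:
  fixes f :: "complex \<Rightarrow> complex"
  assumes "f \<in> borel_measurable circle"
  shows "(LINT z|circle. f (cnj z)) = (LINT z|circle. f z)"
  using integral_distr[OF cnj_measurable_circle assms] by (simp add: circle_distr_cnj)

lemma AE_circle_cnj:
  assumes "AE z in circle. R z"
  shows "AE z in circle. R (cnj z)"
proof -
  have "AE z in distr circle circle cnj. R z"
    unfolding circle_distr_cnj by (rule assms)
  then show ?thesis
    by (rule AE_distrD[OF cnj_measurable_circle])
qed

lemma integral_circle_powi:
  assumes "n \<noteq> 0"
  shows "(LINT z|circle. z powi n) = 0"
proof -
  have pm: "(\<lambda>z. z powi n) \<in> borel_measurable circle"
    unfolding power_int_def by measurable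
  have pm': "(\<lambda>z::complex. z powi n) \<in> borel_measurable (restrict_space borel (sphere 0 1))"
    using pm by (subst measurable_cong_sets[OF sets_circle[symmetric] refl])
  have "(LINT z|circle. z powi n) = (LINT t|uniform_measure lborel {0..<2*pi}. cis t powi n)"
    unfolding circle_def using pm' by (intro integral_distr) auto
  also have "\<dots> = (LINT t|density lborel (\<lambda>t. ennreal (indicator {0..<2*pi} t / (2*pi))). cis (of_int n * t))"
    unfolding uniform_measure_def
    by (intro Bochner_Integration.integral_cong density_cong)
       (auto simp: cis_power_int divide_ennreal[of 1, simplified] split: split_indicator)
  also have "\<dots> = (LINT t|lborel. (indicator {0..<2*pi} t / (2*pi)) *\<^sub>R cis (of_int n * t))"
    by (intro integral_density) (auto intro!: borel_measurable_continuous_onI continuous_intros)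
  also have "\<dots> = (LINT t|lborel. indicator {0..2*pi} t *\<^sub>R (cis (of_int n * t) / (2*pi)))"
  proof (rule integral_cong_AE)
    have "AE t in lborel. t \<noteq> (2*pi::real)"
      by (rule AE_lborel_singleton)
    then show "AE t in lborel. (indicator {0..<2*pi} t / (2*pi)) *\<^sub>R cis (of_int n * t)
        = indicator {0..2*pi} t *\<^sub>R (cis (of_int n * t) / (2*pi))"
      by eventually_elim (auto simp: indicator_def scaleR_conv_of_real)
  qed auto
  also have "\<dots> = cis (of_int n * (2*pi)) / (2*pi* \<i> * n) - cis (of_int n * 0) / (2*pi* \<i> * n)"
  proof (rule integral_FTC_Icc)
    show "((\<lambda>t. cis (of_int n * t) / (2*pi* \<i> * n)) has_vector_derivative
       cis (of_int n * x) / (2*pi)) (at x within {0..2*pi})" for x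
      using assms unfolding cis_conv_exp
      by (auto intro!: derivative_eq_intros has_vector_derivative_real_field simp: field_simps)
  qed (auto intro!: continuous_intros)
  also have "\<dots> = 0"
    using cis_multiple_2pi[of "of_int n"] by (simp add: mult.commute)
  finally show ?thesis .
qed

section \<open>Square integrable and bounded functions\<close>

lemma L2_measurable [measurable_dest]: "f \<in> L2 \<Longrightarrow> f \<in> borel_measurable circle"
  by (simp add: L2_def)

lemma L2_integrable: "f \<in> L2 \<Longrightarrow> integrable circle (\<lambda>z. (cmod (f z))\<^sup>2)"
  by (simp add: L2_def)

lemma Linf_measurable [measurable_dest]: "f \<in> Linf \<Longrightarrow> f \<in> borel_measurable circle"
  by (simp add: Linf_def)

lemma L2_I:
  assumes [measurable]: "f \<in> borel_measurable circle" and g: "integrable circle g"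
    and le: "AE z in circle. (cmod (f z))\<^sup>2 \<le> g z"
  shows "f \<in> L2"
proof -
  have "integrable circle (\<lambda>z. (cmod (f z))\<^sup>2)"
    by (rule Bochner_Integration.integrable_bound[OF g]) (use le in \<open>auto\<close>)
  then show ?thesis by (simp add: L2_def)
qed

lemma L2_add:
  assumes "f \<in> L2" "g \<in> L2"
  shows "(\<lambda>z. f z + g z) \<in> L2"
proof (rule L2_I)
  show "integrable circle (\<lambda>z. 2 * (cmod (f z))\<^sup>2 + 2 * (cmod (g z))\<^sup>2)"
    using assms by (intro Bochner_Integration.integrable_add integrable_mult_right L2_integrable)
  have "(cmod (a + b))\<^sup>2 \<le> 2 * (cmod a)\<^sup>2 + 2 * (cmod b)\<^sup>2" for a b
  proof -
    have "(cmod (a + b))\<^sup>2 \<le> (cmod a + cmod b)\<^sup>2"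
      by (intro power_mono norm_triangle_ineq) auto
    also have "\<dots> \<le> 2 * (cmod a)\<^sup>2 + 2 * (cmod b)\<^sup>2"
      using sum_squares_bound[of "cmod a" "cmod b"] by (simp add: power2_sum)
    finally show ?thesis .
  qed
  then show "AE z in circle. (cmod (f z + g z))\<^sup>2 \<le> 2 * (cmod (f z))\<^sup>2 + 2 * (cmod (g z))\<^sup>2"
    by simp
qed (use assms in measurable)

lemma Linf_mult_L2:
  assumes "m \<in> Linf" "f \<in> L2"
  shows "(\<lambda>z. m z * f z) \<in> L2"
proof -
  obtain C where C: "AE z in circle. cmod (m z) \<le> C"
    using assms by (auto simp: Linf_def)
  show ?thesis
  proof (rule L2_I)
    show "integrable circle (\<lambda>z. C\<^sup>2 * (cmod (f z))\<^sup>2)"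
      using assms by (intro integrable_mult_right L2_integrable)
    show "AE z in circle. (cmod (m z * f z))\<^sup>2 \<le> C\<^sup>2 * (cmod (f z))\<^sup>2"
      using C by eventually_elim (auto simp: norm_mult power_mult_distrib intro!: mult_right_mono power_mono)
  qed (use assms in measurable)
qed

lemma Linf_const: "(\<lambda>z. c) \<in> Linf"
  by (auto simp: Linf_def)

lemma Linf_id: "(\<lambda>z. z) \<in> Linf"
  by (auto simp: Linf_def intro!: exI[of _ 1])

lemma Linf_cnj:
  assumes "m \<in> Linf"
  shows "(\<lambda>z. cnj (m z)) \<in> Linf"
  using assms by (auto simp: Linf_def)

lemma Linf_powi: "(\<lambda>z. z powi n) \<in> Linf"
  unfolding Linf_def power_int_def
  by (auto intro!: exI[of _ 1] AE_I2 simp: norm_power norm_inverse)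

lemma Linf_subset_L2: "m \<in> Linf \<Longrightarrow> m \<in> L2"
  using Linf_mult_L2[of m "\<lambda>_. 1"] by (auto simp: L2_def)

lemma L2_scale: "f \<in> L2 \<Longrightarrow> (\<lambda>z. c * f z) \<in> L2"
  by (intro Linf_mult_L2 Linf_const)

lemma L2_diff: "f \<in> L2 \<Longrightarrow> g \<in> L2 \<Longrightarrow> (\<lambda>z. f z - g z) \<in> L2"
  using L2_add[OF _ L2_scale[of g "-1"], of f] by simp

lemma L2_J:
  assumes "f \<in> L2" shows "J f \<in> L2"
proof -
  have [measurable]: "J f \<in> borel_measurable circle"
    unfolding J_def by (rule measurable_compose[OF cnj_measurable_circle L2_measurable[OF assms]])
  have "integrable (distr circle circle cnj) (\<lambda>z. (cmod (f z))\<^sup>2)"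
    unfolding circle_distr_cnj by (rule L2_integrable[OF assms])
  then have "integrable circle (\<lambda>z. (cmod (f (cnj z)))\<^sup>2)"
    by (rule integrable_distr[OF cnj_measurable_circle])
  then show ?thesis by (simp add: L2_def) (simp add: J_def)
qed

lemma Linf_star:
  assumes "m \<in> Linf" shows "star m \<in> Linf"
proof -
  obtain C where C: "AE z in circle. cmod (m z) \<le> C"
    using assms by (auto simp: Linf_def)
  have "(\<lambda>z. m (cnj z)) \<in> borel_measurable circle"
    by (rule measurable_compose[OF cnj_measurable_circle Linf_measurable[OF assms]])
  then show ?thesis
    using AE_circle_cnj[OF C] by (auto simp: Linf_def star_def)
qed

section \<open>The inner product\<close>

lemma ip_integrable:
  assumes "f \<in> L2" "g \<in> L2"
  shows "integrable circle (\<lambda>z. f z * cnj (g z))"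
proof (rule Bochner_Integration.integrable_bound)
  show "integrable circle (\<lambda>z. (cmod (f z))\<^sup>2 + (cmod (g z))\<^sup>2)"
    using assms by (intro Bochner_Integration.integrable_add L2_integrable)
  have "cmod (a * cnj b) \<le> norm ((cmod a)\<^sup>2 + (cmod b)\<^sup>2)" for a b
  proof -
    have "0 \<le> cmod a * cmod b" by simp
    moreover have "2 * (cmod a * cmod b) \<le> (cmod a)\<^sup>2 + (cmod b)\<^sup>2"
      using sum_squares_bound[of "cmod a" "cmod b"] by simp
    ultimately have "cmod a * cmod b \<le> (cmod a)\<^sup>2 + (cmod b)\<^sup>2" by linarith
    then show ?thesis by (simp add: norm_mult)
  qed
  then show "AE z in circle. norm (f z * cnj (g z)) \<le> norm ((cmod (f z))\<^sup>2 + (cmod (g z))\<^sup>2)"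
    by simp
qed (use assms in measurable)

lemma ip_add_left: "f \<in> L2 \<Longrightarrow> g \<in> L2 \<Longrightarrow> k \<in> L2 \<Longrightarrow> ip (\<lambda>z. f z + g z) k = ip f k + ip g k"
  unfolding ip_def by (simp add: distrib_right Bochner_Integration.integral_add ip_integrable)

lemma ip_diff_left: "f \<in> L2 \<Longrightarrow> g \<in> L2 \<Longrightarrow> k \<in> L2 \<Longrightarrow> ip (\<lambda>z. f z - g z) k = ip f k - ip g k"
  unfolding ip_def by (simp add: left_diff_distrib Bochner_Integration.integral_diff ip_integrable)

lemma ip_scale_left: "ip (\<lambda>z. c * f z) k = c * ip f k"
  unfolding ip_def by (simp add: mult.assoc)

lemma ip_cnj: "cnj (ip f g) = ip g f"
  unfolding ip_def by (simp add: mult.commute flip: Bochner_Integration.integral_cnj)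

lemma ip_add_right: "f \<in> L2 \<Longrightarrow> g \<in> L2 \<Longrightarrow> k \<in> L2 \<Longrightarrow> ip k (\<lambda>z. f z + g z) = ip k f + ip k g"
  using arg_cong[OF ip_add_left[of f g k], of cnj] by (simp add: ip_cnj)

lemma ip_diff_right: "f \<in> L2 \<Longrightarrow> g \<in> L2 \<Longrightarrow> k \<in> L2 \<Longrightarrow> ip k (\<lambda>z. f z - g z) = ip k f - ip k g"
  using arg_cong[OF ip_diff_left[of f g k], of cnj] by (simp add: ip_cnj)

lemma ip_scale_right: "ip k (\<lambda>z. c * f z) = cnj c * ip k f"
  using arg_cong[OF ip_scale_left[of c f k], of cnj] by (simp add: ip_cnj)

lemma ip_mult_left: "ip (\<lambda>z. m z * f z) g = ip f (\<lambda>z. cnj (m z) * g z)"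
  unfolding ip_def by (simp add: algebra_simps)

lemma ip_cong_AE:
  assumes "f \<in> borel_measurable circle" "f' \<in> borel_measurable circle" "g \<in> borel_measurable circle"
    and "AE z in circle. f z = f' z"
  shows "ip f g = ip f' g"
  unfolding ip_def using assms by (intro integral_cong_AE) auto

text \<open>
  The flip is self-adjoint because conjugation preserves the measure of the circle.
\<close>

lemma ip_J:
  assumes "f \<in> L2" "g \<in> L2"
  shows "ip (J f) g = ip f (J g)"
proof -
  have "(\<lambda>z. f z * cnj (g (cnj z))) \<in> borel_measurable circle"
    using assms L2_J[OF assms(2)] unfolding J_def by measurable
  from integral_circle_cnj[OF this] show ?thesis
    by (simp add: ip_def J_def)
qed

lemma ip_self: "ip f f = of_real (LINT z|circle. (cmod (f z))\<^sup>2)"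
  unfolding ip_def complex_norm_square[symmetric] of_real_power[symmetric]
  by (rule integral_complex_of_real)

lemma ip_self_eq_0_AE:
  assumes "f \<in> L2" "ip f f = 0"
  shows "AE z in circle. f z = 0"
proof -
  have "(LINT z|circle. (cmod (f z))\<^sup>2) = 0"
    using assms by (simp add: ip_self)
  then have "AE z in circle. (cmod (f z))\<^sup>2 = 0"
    by (subst (asm) integral_nonneg_eq_0_iff_AE) (use L2_integrable[OF assms(1)] in auto)
  then show ?thesis by simp
qed

section \<open>Completeness and the projection theorem\<close>

lemma nn_integral_L2:
  "f \<in> L2 \<Longrightarrow> (\<integral>\<^sup>+z. ennreal ((cmod (f z))\<^sup>2) \<partial>circle) = ennreal (LINT z|circle. (cmod (f z))\<^sup>2)"
  by (rule nn_integral_eq_integral[OF L2_integrable]) auto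

lemma ennreal_power2_le_imp_le:
  fixes a b :: ennreal
  assumes "a\<^sup>2 \<le> b\<^sup>2"
  shows "a \<le> b"
  using assms
  by (cases a; cases b) (auto simp: ennreal_power power2_le_iff_abs_le top_unique)

text \<open>
  The circle has total mass one, so this is the Cauchy--Schwarz inequality against the constant one.
\<close>

lemma L1_norm_le_L2_norm:
  assumes "f \<in> L2"
  shows "(\<integral>\<^sup>+z. ennreal (cmod (f z)) \<partial>circle) \<le> ennreal (sqrt (LINT z|circle. (cmod (f z))\<^sup>2))"
proof -
  note [measurable] = L2_measurable[OF assms]
  have "(\<integral>\<^sup>+z. ennreal (cmod (f z)) * 1 \<partial>circle)\<^sup>2 \<le>
      (\<integral>\<^sup>+z. (ennreal (cmod (f z)))\<^sup>2 \<partial>circle) * (\<integral>\<^sup>+z. 1\<^sup>2 \<partial>circle)"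
    by (rule Cauchy_Schwarz_nn_integral; measurable)
  also have "\<dots> = (\<integral>\<^sup>+z. ennreal ((cmod (f z))\<^sup>2) \<partial>circle)"
    by (simp add: ennreal_power circle.emeasure_space_1[unfolded space_circle])
  also have "\<dots> = (ennreal (sqrt (LINT z|circle. (cmod (f z))\<^sup>2)))\<^sup>2"
    using assms by (simp add: nn_integral_L2 ennreal_power)
  finally show ?thesis
    by (auto dest: ennreal_power2_le_imp_le)
qed

text \<open>
  The Riesz--Fischer argument. The prescribed geometric rate makes the increments summable in
  \<open>L\<^sup>1\<close>, hence summable almost everywhere, so the sequence converges almost everywhere without
  passing to a subsequence; Fatou's lemma then carries the rate over to the limit.
\<close>

lemma L2_complete:
  assumes u: "\<And>n. u n \<in> L2"
    and fast: "\<And>n m. n \<le> m \<Longrightarrow> (LINT z|circle. (cmod (u m z - u n z))\<^sup>2) \<le> 4 * (1/16) ^ n"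
  shows "\<exists>v\<in>L2. \<forall>n. (LINT z|circle. (cmod (v z - u n z))\<^sup>2) \<le> 4 * (1/16) ^ n"
proof -
  have um [measurable]: "u n \<in> borel_measurable circle" for n
    by (rule L2_measurable[OF u])
  have d2: "(\<lambda>z. u m z - u n z) \<in> L2" for n m
    by (intro L2_diff u)
  have b: "(\<integral>\<^sup>+z. ennreal (cmod (u (Suc n) z - u n z)) \<partial>circle) \<le> ennreal (2 * (1/4) ^ n)" for n
  proof -
    have "sqrt (LINT z|circle. (cmod (u (Suc n) z - u n z))\<^sup>2) \<le> 2 * (1/4) ^ n"
    proof (rule real_le_lsqrt)
      have "(2 * (1/4) ^ n)\<^sup>2 = 4 * (1/16::real) ^ n"
        by (simp add: power2_eq_square field_simps flip: power_mult_distrib)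
      with fast[of n "Suc n"] show "(LINT z|circle. (cmod (u (Suc n) z - u n z))\<^sup>2) \<le> (2 * (1/4) ^ n)\<^sup>2"
        by simp
    qed auto
    with L1_norm_le_L2_norm[OF d2, of "Suc n" n] show ?thesis
      by (meson ennreal_leI order_trans)
  qed
  have "(\<integral>\<^sup>+z. (\<Sum>n. ennreal (cmod (u (Suc n) z - u n z))) \<partial>circle)
      = (\<Sum>n. \<integral>\<^sup>+z. ennreal (cmod (u (Suc n) z - u n z)) \<partial>circle)"
    by (intro nn_integral_suminf) measurable
  also have "\<dots> \<le> (\<Sum>n. ennreal (2 * (1/4) ^ n))"
    by (intro suminf_le b summableI)
  also have "\<dots> < \<infinity>"
    by (subst suminf_ennreal2) (auto intro!: summable_mult summable_geometric)
  finally have "AE z in circle. (\<Sum>n. ennreal (cmod (u (Suc n) z - u n z))) \<noteq> \<infinity>"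
    by (intro nn_integral_noteq_infinite) (auto simp: less_top)
  then have conv: "AE z in circle. (\<lambda>n. u n z) \<longlonglongrightarrow> lim (\<lambda>n. u n z)"
  proof eventually_elim
    case (elim z)
    then have "summable (\<lambda>n. cmod (u (Suc n) z - u n z))"
      by (intro summable_suminf_not_top) auto
    then have "summable (\<lambda>n. u (Suc n) z - u n z)"
      by (rule summable_norm_cancel)
    then have "convergent (\<lambda>n. (\<Sum>k<n. u (Suc k) z - u k z) + u 0 z)"
      unfolding summable_iff_convergent by (intro convergent_add convergent_const)
    moreover have "(\<Sum>k<n. u (Suc k) z - u k z) + u 0 z = u n z" for n
      by (simp only: sum_lessThan_telescope[of "\<lambda>k. u k z" n]) simp
    ultimately have "convergent (\<lambda>n. u n z)"
      by (simp only:)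
    then show ?case
      by (rule convergent_LIMSEQ_iff[THEN iffD1])
  qed
  define v where "v z = lim (\<lambda>n. u n z)" for z
  have vm [measurable]: "v \<in> borel_measurable circle"
    unfolding v_def by measurable
  have fatou: "(\<integral>\<^sup>+z. ennreal ((cmod (v z - u n z))\<^sup>2) \<partial>circle) \<le> ennreal (4 * (1/16) ^ n)" for n
  proof -
    have "(\<integral>\<^sup>+z. ennreal ((cmod (v z - u n z))\<^sup>2) \<partial>circle) =
        (\<integral>\<^sup>+z. liminf (\<lambda>m. ennreal ((cmod (u m z - u n z))\<^sup>2)) \<partial>circle)"
    proof (rule nn_integral_cong_AE)
      show "AE z in circle. ennreal ((cmod (v z - u n z))\<^sup>2) = liminf (\<lambda>m. ennreal ((cmod (u m z - u n z))\<^sup>2))"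
        using conv
      proof eventually_elim
        case (elim z)
        have "(\<lambda>m. ennreal ((cmod (u m z - u n z))\<^sup>2)) \<longlonglongrightarrow> ennreal ((cmod (v z - u n z))\<^sup>2)"
          unfolding v_def by (intro tendsto_intros elim)
        then show ?case
          by (intro lim_imp_Liminf[symmetric]) auto
      qed
    qed
    also have "\<dots> \<le> liminf (\<lambda>m. \<integral>\<^sup>+z. ennreal ((cmod (u m z - u n z))\<^sup>2) \<partial>circle)"
      by (intro nn_integral_liminf) measurable
    also have "\<dots> \<le> liminf (\<lambda>m. ennreal (4 * (1/16) ^ n))"
    proof (rule Liminf_mono)
      show "\<forall>\<^sub>F m in sequentially. (\<integral>\<^sup>+z. ennreal ((cmod (u m z - u n z))\<^sup>2) \<partial>circle) \<le> ennreal (4 * (1/16) ^ n)"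
        using eventually_ge_at_top[of n]
        by eventually_elim (simp add: nn_integral_L2[OF d2] fast ennreal_leI)
    qed
    also have "\<dots> = ennreal (4 * (1/16) ^ n)"
      by (simp add: Liminf_const)
    finally show ?thesis .
  qed
  have "(\<lambda>z. v z - u 0 z) \<in> L2"
    using fatou[of 0] by (auto simp: L2_def integrable_iff_bounded le_less_trans)
  from L2_add[OF this u[of 0]] have v: "v \<in> L2" by simp
  have "(LINT z|circle. (cmod (v z - u n z))\<^sup>2) \<le> 4 * (1/16) ^ n" for n
    using fatou[of n] by (simp add: nn_integral_L2[OF L2_diff[OF v u]])
  with v show ?thesis by blast
qed

lemma ip_Cauchy_Schwarz:
  assumes "f \<in> L2" "g \<in> L2"
  shows "cmod (ip f g) \<le> sqrt (LINT z|circle. (cmod (f z))\<^sup>2) * sqrt (LINT z|circle. (cmod (g z))\<^sup>2)"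
proof -
  note [measurable] = assms[THEN L2_measurable]
  have "(\<integral>\<^sup>+z. ennreal (cmod (f z)) * ennreal (cmod (g z)) \<partial>circle)\<^sup>2 \<le>
      (\<integral>\<^sup>+z. (ennreal (cmod (f z)))\<^sup>2 \<partial>circle) * (\<integral>\<^sup>+z. (ennreal (cmod (g z)))\<^sup>2 \<partial>circle)"
    by (rule Cauchy_Schwarz_nn_integral; measurable)
  also have "\<dots> = (ennreal (sqrt (LINT z|circle. (cmod (f z))\<^sup>2) * sqrt (LINT z|circle. (cmod (g z))\<^sup>2)))\<^sup>2"
    using assms by (simp add: nn_integral_L2 ennreal_power power_mult_distrib ennreal_mult)
  finally have "(\<integral>\<^sup>+z. ennreal (cmod (f z)) * ennreal (cmod (g z)) \<partial>circle) \<le>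
     ennreal (sqrt (LINT z|circle. (cmod (f z))\<^sup>2) * sqrt (LINT z|circle. (cmod (g z))\<^sup>2))"
    by (rule ennreal_power2_le_imp_le)
  moreover have "ennreal (cmod (ip f g)) \<le> (\<integral>\<^sup>+z. ennreal (cmod (f z)) * ennreal (cmod (g z)) \<partial>circle)"
    unfolding ip_def using integral_norm_bound_ennreal[OF ip_integrable[OF assms]]
    by (simp add: norm_mult ennreal_mult)
  ultimately have "ennreal (cmod (ip f g)) \<le>
      ennreal (sqrt (LINT z|circle. (cmod (f z))\<^sup>2) * sqrt (LINT z|circle. (cmod (g z))\<^sup>2))"
    by (rule order_trans[rotated])
  then show ?thesis
    by (subst (asm) ennreal_le_iff) auto
qed

lemma integral_diff_square:
  assumes "f \<in> L2" "g \<in> L2"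
  shows "(LINT z|circle. (cmod (f z - g z))\<^sup>2) =
    (LINT z|circle. (cmod (f z))\<^sup>2) - 2 * Re (ip f g) + (LINT z|circle. (cmod (g z))\<^sup>2)"
proof -
  have "complex_of_real (LINT z|circle. (cmod (f z - g z))\<^sup>2) = ip (\<lambda>z. f z - g z) (\<lambda>z. f z - g z)"
    by (simp add: ip_self)
  also have "\<dots> = ip f f - ip f g - (cnj (ip f g) - ip g g)"
    using assms by (simp add: ip_diff_left ip_diff_right L2_diff ip_cnj)
  finally have "Re (complex_of_real (LINT z|circle. (cmod (f z - g z))\<^sup>2)) = Re (ip f f - ip f g - (cnj (ip f g) - ip g g))"
    by simp
  then show ?thesis by (simp add: ip_self)
qed

text \<open>
  Closedness is required under weak limits of sequences. For a subspace this amounts to closedness in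
  norm, but for sets that are cut out by the vanishing of inner products, such as \<open>H2\<close>, it
  is immediate.
\<close>

definition weakly_closed_subspace :: "(complex \<Rightarrow> complex) set \<Rightarrow> bool" where
  "weakly_closed_subspace S \<longleftrightarrow> S \<subseteq> L2 \<and> (\<lambda>_. 0) \<in> S \<and>
     (\<forall>f\<in>S. \<forall>g\<in>S. (\<lambda>z. f z + g z) \<in> S) \<and> (\<forall>c. \<forall>f\<in>S. (\<lambda>z. c * f z) \<in> S) \<and>
     (\<forall>u v. (\<forall>n. u n \<in> S) \<longrightarrow> v \<in> L2 \<longrightarrow> (\<forall>k\<in>L2. (\<lambda>n. ip (u n) k) \<longlonglongrightarrow> ip v k) \<longrightarrow> v \<in> S)"

text \<open>
  The Hilbert space projection theorem. A sequence in \<open>S\<close> that minimizes the distance to \<open>f\<close> is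
  Cauchy by the parallelogram law, and its limit \<open>v\<close> lies in \<open>S\<close>. Orthogonality of \<open>f - v\<close> to \<open>S\<close>
  is obtained as the limit of approximate orthogonality: if the squared distance of \<open>u n\<close> to \<open>f\<close>
  exceeds the infimum by at most \<open>(1/16)^n\<close>, then moving \<open>u n\<close> in the direction of \<open>k\<close> gains at most that
  much, which bounds \<open>ip (f - u n) k\<close>.
\<close>

lemma projection_exists:
  assumes S: "weakly_closed_subspace S" and f: "f \<in> L2"
  shows "\<exists>v\<in>S. \<forall>k\<in>S. ip (\<lambda>z. f z - v z) k = 0"
proof -
  define E where "E g = (LINT z|circle. (cmod (f z - g z))\<^sup>2)" for g
  define d where "d = Inf (E ` S)"
  have sub: "S \<subseteq> L2" and zero: "(\<lambda>_. 0) \<in> S"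
    and add: "\<And>f g. f \<in> S \<Longrightarrow> g \<in> S \<Longrightarrow> (\<lambda>z. f z + g z) \<in> S"
    and scale: "\<And>c f. f \<in> S \<Longrightarrow> (\<lambda>z. c * f z) \<in> S"
    and closed: "\<And>u v. (\<And>n. u n \<in> S) \<Longrightarrow> v \<in> L2 \<Longrightarrow> (\<And>k. k \<in> L2 \<Longrightarrow> (\<lambda>n. ip (u n) k) \<longlonglongrightarrow> ip v k) \<Longrightarrow> v \<in> S"
    using S unfolding weakly_closed_subspace_def by blast+
  have bdd: "bdd_below (E ` S)"
    by (rule bdd_belowI[of _ 0]) (auto simp: E_def)
  have d_le: "d \<le> E g" if "g \<in> S" for g
    unfolding d_def using that bdd by (intro cInf_lower) auto
  have "\<exists>g\<in>S. E g < d + (1/16) ^ n" for n :: nat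
    using cInf_lessD[of "E ` S" "d + (1/16) ^ n"] zero unfolding d_def by fastforce
  then obtain u where uS: "\<And>n. u n \<in> S" and uE: "\<And>n. E (u n) < d + (1/16) ^ n"
    by metis
  have u: "u n \<in> L2" for n using uS sub by blast
  have "(LINT z|circle. (cmod (u m z - u n z))\<^sup>2) \<le> 4 * (1/16) ^ n" if "n \<le> m" for n m
  proof -
    \<comment> \<open>Parallelogram law for \<open>f - u n\<close> and \<open>f - u m\<close>, whose half sum is \<open>f\<close> minus the midpoint.\<close>
    let ?a = "\<lambda>z. f z - u n z" and ?b = "\<lambda>z. f z - u m z"
    have ab: "?a \<in> L2" "?b \<in> L2" by (intro L2_diff f u)+
    have mS: "(\<lambda>z. (1/2) * (u n z + u m z)) \<in> S"
      by (intro scale add uS)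
    have I1: "(LINT z|circle. (cmod (u m z - u n z))\<^sup>2) = E (u n) - 2 * Re (ip ?a ?b) + E (u m)"
      using integral_diff_square[OF ab] by (simp add: E_def)
    have "(LINT z|circle. (cmod (f z - (1/2) * (u n z + u m z)))\<^sup>2)
        = (LINT z|circle. 1/4 * (cmod (?a z - (-1) * ?b z))\<^sup>2)"
    proof (rule Bochner_Integration.integral_cong[OF refl])
      fix z
      have "f z - (1/2) * (u n z + u m z) = (1/2) * (?a z - (-1) * ?b z)"
        by (simp add: field_simps)
      then show "(cmod (f z - (1/2) * (u n z + u m z)))\<^sup>2 = 1/4 * (cmod (?a z - (-1) * ?b z))\<^sup>2"
        by (simp only: norm_mult power_mult_distrib) (simp add: power2_eq_square)
    qed
    also have "\<dots> = 1/4 * (LINT z|circle. (cmod (?a z - (-1) * ?b z))\<^sup>2)"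
      by (rule integral_mult_right_zero)
    also have "(LINT z|circle. (cmod (?a z - (-1) * ?b z))\<^sup>2) = E (u n) + 2 * Re (ip ?a ?b) + E (u m)"
      using integral_diff_square[OF ab(1) L2_scale[OF ab(2), of "-1"]]
      by (simp only: ip_scale_right) (simp add: E_def norm_minus_commute)
    finally have "E (\<lambda>z. (1/2) * (u n z + u m z)) = 1/4 * (E (u n) + 2 * Re (ip ?a ?b) + E (u m))"
      by (simp only: E_def)
    with d_le[OF mS] have "4 * d \<le> E (u n) + 2 * Re (ip ?a ?b) + E (u m)" by simp
    with I1 uE[of n] uE[of m] have "(LINT z|circle. (cmod (u m z - u n z))\<^sup>2) \<le> 2 * (1/16) ^ n + 2 * (1/16) ^ m"
      by simp
    moreover have "(1/16::real) ^ m \<le> (1/16) ^ n"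
      using that by (intro power_decreasing) auto
    ultimately show ?thesis by linarith
  qed
  from L2_complete[OF u this] obtain v where v: "v \<in> L2"
    and vu: "\<And>n. (LINT z|circle. (cmod (v z - u n z))\<^sup>2) \<le> 4 * (1/16) ^ n"
    by blast
  have geo: "(\<lambda>n. sqrt (c * (1/16::real) ^ n)) \<longlonglongrightarrow> 0" for c
    using tendsto_real_sqrt[OF tendsto_mult_right_zero[OF LIMSEQ_realpow_zero[of "1/16::real"]], of c] by simp
  have lim: "(\<lambda>n. ip (\<lambda>z. v z - u n z) k) \<longlonglongrightarrow> 0" if "k \<in> L2" for k
  proof (rule Lim_null_comparison)
    show "(\<lambda>n. sqrt (4 * (1/16) ^ n) * sqrt (LINT z|circle. (cmod (k z))\<^sup>2)) \<longlonglongrightarrow> 0"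
      by (intro tendsto_mult_left_zero geo)
    show "\<forall>\<^sub>F n in sequentially. norm (ip (\<lambda>z. v z - u n z) k) \<le>
       sqrt (4 * (1/16) ^ n) * sqrt (LINT z|circle. (cmod (k z))\<^sup>2)"
      by (intro always_eventually allI order_trans[OF ip_Cauchy_Schwarz[OF L2_diff[OF v u] that]]
          mult_right_mono real_sqrt_le_mono vu) auto
  qed
  have vS: "v \<in> S"
  proof (rule closed[OF uS v])
    fix k assume k: "k \<in> L2"
    from tendsto_diff[OF tendsto_const[of "ip v k"] lim[OF k]]
    show "(\<lambda>n. ip (u n) k) \<longlonglongrightarrow> ip v k"
      by (simp add: ip_diff_left v u k)
  qed
  have "ip (\<lambda>z. f z - v z) k = 0" if kS: "k \<in> S" for k
  proof -
    have k: "k \<in> L2" using kS sub by blast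
    define N where "N = (LINT z|circle. (cmod (k z))\<^sup>2)"
    have N: "N \<ge> 0" by (simp add: N_def)
    have "cmod (ip (\<lambda>z. f z - u n z) k) \<le> sqrt ((1 + N) * (1/16) ^ n)" for n
    proof (rule real_le_rsqrt)
      define c where "c = ip (\<lambda>z. f z - u n z) k"
      \<comment> \<open>The optimal step is \<open>1 / N\<close>; adding one avoids the case \<open>N = 0\<close> and still gains \<open>t\<close> times
        the square of the modulus of \<open>c\<close>.\<close>
      define t where "t = 1 / (1 + N)"
      have t: "t > 0" "t * N \<le> 1" "t * (1 + N) = 1" using N by (auto simp: t_def field_simps)
      let ?g = "\<lambda>z. u n z + (of_real t * c) * k z"
      have "d \<le> E ?g" by (intro d_le add scale kS uS)
      also have "E ?g = (LINT z|circle. (cmod ((f z - u n z) - (of_real t * c) * k z))\<^sup>2)"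
        unfolding E_def by (simp add: algebra_simps)
      also have "\<dots> = E (u n) - 2 * Re (cnj (of_real t * c) * c) + (LINT z|circle. (cmod (of_real t * c * k z))\<^sup>2)"
        by (subst integral_diff_square[OF L2_diff[OF f u] L2_scale[OF k]])
           (simp only: ip_scale_right c_def E_def)
      also have "(LINT z|circle. (cmod (of_real t * c * k z))\<^sup>2) = (t * cmod c)\<^sup>2 * N"
        unfolding N_def using t by (simp add: norm_mult power_mult_distrib)
      also have "Re (cnj (of_real t * c) * c) = t * (cmod c)\<^sup>2"
        unfolding cmod_power2 by (simp add: power2_eq_square algebra_simps)
      finally have "2 * (t * (cmod c)\<^sup>2) \<le> (1/16) ^ n + (t * cmod c)\<^sup>2 * N"
        using uE[of n] by simp
      also have "(t * cmod c)\<^sup>2 * N = (t * (cmod c)\<^sup>2) * (t * N)"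
        by (simp add: power2_eq_square)
      also have "\<dots> \<le> (t * (cmod c)\<^sup>2) * 1"
        using t by (intro mult_left_mono) auto
      finally have "t * (cmod c)\<^sup>2 \<le> (1/16) ^ n" by simp
      then have "(1 + N) * (t * (cmod c)\<^sup>2) \<le> (1 + N) * (1/16) ^ n"
        using N by (intro mult_left_mono) auto
      also have "(1 + N) * (t * (cmod c)\<^sup>2) = (cmod c)\<^sup>2"
        using t(3) by (simp only: mult.assoc[symmetric] mult.commute[of _ t])
      finally show "(cmod (ip (\<lambda>z. f z - u n z) k))\<^sup>2 \<le> (1 + N) * (1/16) ^ n"
        by (simp add: c_def)
    qed
    then have "(\<lambda>n. ip (\<lambda>z. f z - u n z) k) \<longlonglongrightarrow> 0"
      by (intro Lim_null_comparison[OF _ geo[of "1 + N"]] always_eventually) auto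
    from tendsto_diff[OF this lim[OF k]]
    have "(\<lambda>n. ip (\<lambda>z. f z - v z) k) \<longlonglongrightarrow> 0"
      by (simp add: ip_diff_left f v u k)
    then show ?thesis by (simp add: LIMSEQ_const_iff)
  qed
  with vS show ?thesis by blast
qed

section \<open>The Hardy space\<close>

abbreviation ae_eq :: "(complex \<Rightarrow> complex) \<Rightarrow> (complex \<Rightarrow> complex) \<Rightarrow> bool" (infix "\<doteq>" 50) where
  "f \<doteq> g \<equiv> (AE z in circle. f z = g z)"

lemma ip_cong_circle:
  "(\<And>z. cmod z = 1 \<Longrightarrow> f z = f' z) \<Longrightarrow> (\<And>z. cmod z = 1 \<Longrightarrow> g z = g' z) \<Longrightarrow> ip f g = ip f' g'"
  unfolding ip_def by (intro Bochner_Integration.integral_cong) auto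

lemma circle_inverse: "cmod z = 1 \<Longrightarrow> inverse z = cnj z"
  by (rule inverse_unique) (simp flip: complex_norm_square)

lemma circle_powi:
  assumes "cmod z = 1"
  shows "z powi (n + 1) = z * z powi n" "z powi (n - 1) = cnj z * z powi n"
proof -
  have "z \<noteq> 0" using assms by auto
  then show "z powi (n + 1) = z * z powi n" "z powi (n - 1) = cnj z * z powi n"
    by (simp_all add: power_int_add power_int_diff divide_inverse circle_inverse[OF assms])
qed

lemma fourier_coeff_0: "fourier_coeff f 0 = ip f (\<lambda>_. 1)"
  by (simp add: fourier_coeff_def)

lemma ip_cnj_id: "ip f cnj = fourier_coeff f (-1)"
  unfolding fourier_coeff_def by (rule ip_cong_circle) (auto simp: circle_inverse)

lemma fourier_coeff_const: "n \<noteq> 0 \<Longrightarrow> fourier_coeff (\<lambda>_. c) n = 0"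
  using integral_circle_powi[of n]
  by (simp add: fourier_coeff_def ip_def del: complex_cnj_power_int)

lemma ip_const_1: "ip (\<lambda>_. c) (\<lambda>_. 1) = c"
  by (simp add: ip_def circle.prob_space[unfolded space_circle])

lemma H2_L2: "f \<in> H2 \<Longrightarrow> f \<in> L2"
  by (simp add: H2_def)

lemma H2_coeff: "f \<in> H2 \<Longrightarrow> n < 0 \<Longrightarrow> fourier_coeff f n = 0"
  by (simp add: H2_def)

lemma powi_L2: "(\<lambda>z. z powi n) \<in> L2"
  by (intro Linf_subset_L2 Linf_powi)

lemma const_L2: "(\<lambda>_. c) \<in> L2"
  by (intro Linf_subset_L2 Linf_const)

lemma cnj_L2: "cnj \<in> L2"
  using Linf_subset_L2[OF Linf_cnj[OF Linf_id]] by simp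

lemma H2_add: "f \<in> H2 \<Longrightarrow> g \<in> H2 \<Longrightarrow> (\<lambda>z. f z + g z) \<in> H2"
  unfolding H2_def fourier_coeff_def by (auto simp: L2_add ip_add_left powi_L2)

lemma H2_scale: "f \<in> H2 \<Longrightarrow> (\<lambda>z. c * f z) \<in> H2"
  unfolding H2_def fourier_coeff_def by (auto simp: L2_scale ip_scale_left)

lemma H2_diff: "f \<in> H2 \<Longrightarrow> g \<in> H2 \<Longrightarrow> (\<lambda>z. f z - g z) \<in> H2"
  using H2_add[OF _ H2_scale[of g "-1"], of f] by simp

lemma H2_const: "(\<lambda>_. c) \<in> H2"
  by (simp add: H2_def const_L2 fourier_coeff_const)

lemma weakly_closed_subspace_H2: "weakly_closed_subspace H2"
  unfolding weakly_closed_subspace_def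
proof (intro conjI allI impI ballI)
  fix u v assume u: "\<forall>n. u n \<in> H2" and v: "v \<in> L2" and lim: "\<forall>k\<in>L2. (\<lambda>n. ip (u n) k) \<longlonglongrightarrow> ip v k"
  have "fourier_coeff v m = 0" if "m < 0" for m
  proof -
    have "(\<lambda>n. ip (u n) (\<lambda>z. z powi m)) \<longlonglongrightarrow> fourier_coeff v m"
      unfolding fourier_coeff_def using lim powi_L2 by blast
    moreover have "ip (u n) (\<lambda>z. z powi m) = 0" for n
      using H2_coeff[of "u n" m] u that by (simp add: fourier_coeff_def)
    ultimately show ?thesis by (simp add: LIMSEQ_const_iff)
  qed
  with v show "v \<in> H2" by (simp add: H2_def)
qed (auto intro: H2_add H2_scale H2_const H2_L2)

text \<open>
  The operator \<open>P\<close> is given by a choice, which is meaningful because projections onto \<open>H2\<close> exist.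
\<close>

lemma P_H2: "f \<in> L2 \<Longrightarrow> P f \<in> H2"
  and ip_P: "f \<in> L2 \<Longrightarrow> k \<in> H2 \<Longrightarrow> ip (P f) k = ip f k"
proof -
  assume f: "f \<in> L2"
  have "\<exists>g. g \<in> H2 \<and> (\<forall>k\<in>H2. ip (f - g) k = 0)"
    using projection_exists[OF weakly_closed_subspace_H2 f] by (auto simp: fun_diff_def)
  from someI_ex[OF this] have *: "P f \<in> H2" "\<forall>k\<in>H2. ip (f - P f) k = 0"
    by (simp_all add: P_def orth_proj_def)
  from *(1) show "P f \<in> H2" .
  assume "k \<in> H2"
  with * f show "ip (P f) k = ip f k"
    by (simp add: fun_diff_def ip_diff_left H2_L2)
qed

lemma H2_shift:
  assumes "g \<in> H2"
  shows "(\<lambda>z. z * g z) \<in> H2"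
proof -
  have "fourier_coeff (\<lambda>z. z * g z) n = fourier_coeff g (n - 1)" for n
    unfolding fourier_coeff_def ip_mult_left
    by (rule ip_cong_circle) (auto simp: circle_powi)
  then show ?thesis
    using assms by (auto simp: H2_def Linf_mult_L2 Linf_id)
qed

definition backward_shift :: "(complex \<Rightarrow> complex) \<Rightarrow> complex \<Rightarrow> complex" where
  "backward_shift g = (\<lambda>z. cnj z * (g z - fourier_coeff g 0))"

lemma H2_backward_shift:
  assumes g: "g \<in> H2"
  shows "backward_shift g \<in> H2"
proof -
  let ?g = "\<lambda>z. g z - fourier_coeff g 0"
  have g': "?g \<in> L2" by (intro L2_diff H2_L2 g const_L2)
  have "fourier_coeff (\<lambda>z. cnj z * ?g z) n = 0" if "n < 0" for n
  proof -
    have "fourier_coeff (\<lambda>z. cnj z * ?g z) n = ip ?g (\<lambda>z. z powi (n + 1))"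
      unfolding fourier_coeff_def ip_mult_left
      by (rule ip_cong_circle) (auto simp: circle_powi)
    also have "\<dots> = fourier_coeff g (n + 1) - fourier_coeff (\<lambda>_. fourier_coeff g 0) (n + 1)"
      unfolding fourier_coeff_def by (intro ip_diff_left H2_L2 g const_L2 powi_L2)
    also have "\<dots> = 0"
    proof (cases "n = -1")
      case True
      then show ?thesis by (simp add: fourier_coeff_0 ip_const_1)
    next
      case False
      with that show ?thesis by (simp add: H2_coeff[OF g] fourier_coeff_const)
    qed
    finally show ?thesis .
  qed
  then show ?thesis
    using Linf_mult_L2[OF Linf_cnj[OF Linf_id] g'] by (simp add: H2_def backward_shift_def)
qed

lemma inner_function_Linf: "inner_function \<theta> \<Longrightarrow> \<theta> \<in> Linf"
  unfolding inner_function_def Linf_def by (auto intro!: exI[of _ 1] elim: eventually_mono)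

text \<open>
  For \<open>r < 1\<close> the dilation \<open>F (r z)\<close> is an absolutely convergent power series on the circle, and each
  \<open>z^k * g\<close> is in \<open>H2\<close>, so the negative coefficients of \<open>F (r z) * g z\<close> vanish. As \<open>r\<close> tends to 1,
  dominated convergence, with the bound of \<open>F\<close> times the modulus of \<open>g\<close>, gives the same
  for \<open>\<theta> * g\<close>.
\<close>

lemma inner_function_mult_H2:
  assumes inner: "inner_function \<theta>" and g: "g \<in> H2"
  shows "(\<lambda>z. \<theta> z * g z) \<in> H2"
proof -
  obtain F where hol: "F holomorphic_on ball 0 1" and bd: "bounded (F ` ball 0 1)"
    and lim: "AE z in circle. ((\<lambda>r. F (complex_of_real r * z)) \<longlongrightarrow> \<theta> z) (at_left 1)"
    using inner by (auto simp: inner_function_def)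
  obtain M where M: "\<And>z. cmod z < 1 \<Longrightarrow> cmod (F z) \<le> M"
    using bd unfolding bounded_iff by (metis imageI mem_ball_0)
  have gL: "g \<in> L2" and [measurable]: "g \<in> borel_measurable circle" "\<theta> \<in> borel_measurable circle"
    using g H2_L2 L2_measurable inner by (auto simp: inner_function_def)
  have "fourier_coeff (\<lambda>z. \<theta> z * g z) n = 0" if n: "n < 0" for n
  proof -
    define e where "e z = cnj (z powi n)" for z :: complex
    have em [measurable]: "e \<in> borel_measurable circle"
      unfolding e_def by (rule Linf_measurable[OF Linf_cnj[OF Linf_powi]])
    have e1: "cmod (e z) = 1" if "cmod z = 1" for z
      using that by (simp add: e_def norm_power_int)
    have gint: "integrable circle (\<lambda>z. cmod (g z))"
      using circle.square_integrable_imp_integrable[of "\<lambda>z. cmod (g z)"] L2_integrable[OF gL] by simp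
    have dil: "(LINT z|circle. F (of_real r * z) * g z * e z) = 0"
      and dilm: "(\<lambda>z. F (of_real r * z)) \<in> borel_measurable circle" if r: "0 < r" "r < 1" for r
    proof -
      define a where "a k = (deriv ^^ k) F 0 / fact k" for k
      have ser: "(\<lambda>k. a k * w ^ k) sums F w" if "cmod w < 1" for w
        using holomorphic_power_series[OF hol, of w] that by (simp add: a_def)
      have "continuous_on (sphere 0 1) (\<lambda>z. F (of_real r * z))"
        by (rule continuous_on_compose2[OF holomorphic_on_imp_continuous_on[OF hol]])
           (use r in \<open>auto intro!: continuous_intros simp: norm_mult\<close>)
      then show "(\<lambda>z. F (of_real r * z)) \<in> borel_measurable circle"
        by (subst measurable_cong_sets[OF sets_circle refl])
           (rule borel_measurable_continuous_on_restrict)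
      define T where "T k z = a k * of_real r ^ k * (z ^ k * g z * e z)" for k z
      have zk: "(\<lambda>z. z ^ k * g z) \<in> H2" for k
      proof (induction k)
        case (Suc k)
        from H2_shift[OF Suc] show ?case by (simp add: mult.assoc)
      qed (simp add: g)
      have Tint0: "integrable circle (\<lambda>z. z ^ k * g z * e z)" for k
        unfolding e_def by (rule ip_integrable[OF H2_L2[OF zk] powi_L2])
      have Tint: "integrable circle (T k)" for k
        unfolding T_def by (intro integrable_mult_right Tint0)
      have T0: "(LINT z|circle. T k z) = 0" for k
        using H2_coeff[OF zk n, of k]
        by (simp add: T_def fourier_coeff_def ip_def e_def del: complex_cnj_power_int)
      have nT: "norm (T k z) = norm (a k * of_real r ^ k) * cmod (g z)" if "cmod z = 1" for k z
        using that by (simp add: T_def norm_mult norm_power e1)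
      have summ: "summable (\<lambda>k. norm (a k * of_real r ^ k))"
      proof (rule powser_insidea)
        show "summable (\<lambda>k. a k * (of_real ((1 + r) / 2)) ^ k)"
          by (rule sums_summable[OF ser]) (use r in \<open>auto simp del: of_real_divide of_real_add\<close>)
        show "norm (complex_of_real r) < norm (complex_of_real ((1 + r) / 2))"
          using r by (simp del: of_real_divide of_real_add)
      qed
      have "(\<lambda>k. LINT z|circle. T k z) sums (LINT z|circle. (\<Sum>k. T k z))"
      proof (rule sums_integral[OF Tint])
        show "AE z in circle. summable (\<lambda>k. norm (T k z))"
          by (rule AE_I2) (simp add: nT summable_mult2[OF summ])
        have "(LINT z|circle. norm (T k z)) = norm (a k * of_real r ^ k) * (LINT z|circle. cmod (g z))" for k
        proof -
          have "(LINT z|circle. norm (T k z)) = (LINT z|circle. norm (a k * of_real r ^ k) * cmod (g z))"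
            by (rule Bochner_Integration.integral_cong[OF refl nT]) simp
          then show ?thesis by (simp only: integral_mult_right_zero)
        qed
        then show "summable (\<lambda>k. LINT z|circle. norm (T k z))"
          by (simp only: summable_mult2[OF summ])
      qed
      then have "(LINT z|circle. (\<Sum>k. T k z)) = 0"
        by (simp add: T0 sums_0 sums_unique2)
      moreover have "(\<Sum>k. T k z) = F (of_real r * z) * g z * e z" if "cmod z = 1" for z
      proof -
        have "(\<lambda>k. a k * (of_real r * z) ^ k) sums F (of_real r * z)"
          using that r by (intro ser) (simp add: norm_mult)
        from sums_mult2[OF this, of "g z * e z"] show ?thesis
          by (intro sums_unique[symmetric]) (simp add: T_def power_mult_distrib mult_ac)
      qed
      then have "(LINT z|circle. (\<Sum>k. T k z)) = (LINT z|circle. F (of_real r * z) * g z * e z)"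
        by (intro Bochner_Integration.integral_cong) auto
      ultimately show "(LINT z|circle. F (of_real r * z) * g z * e z) = 0" by simp
    qed
    define r :: "nat \<Rightarrow> real" where "r j = 1 - 1 / (real j + 2)" for j
    have r: "0 < r j" "r j < 1" for j by (auto simp: r_def field_simps)
    have rlim: "filterlim r (at_left 1) sequentially"
      unfolding filterlim_at r_def
    proof (intro conjI)
      show "((\<lambda>j. 1 - 1 / (real j + 2)) \<longlongrightarrow> 1) sequentially"
        by real_asymp
    qed (auto simp: field_simps)
    have "(\<lambda>j. LINT z|circle. F (of_real (r j) * z) * g z * e z) \<longlonglongrightarrow> (LINT z|circle. \<theta> z * g z * e z)"
    proof (rule integral_dominated_convergence)
      show "integrable circle (\<lambda>z. M * cmod (g z))"
        using gint by simp
      show "AE z in circle. (\<lambda>j. F (of_real (r j) * z) * g z * e z) \<longlonglongrightarrow> \<theta> z * g z * e z"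
        using lim by eventually_elim (intro tendsto_mult tendsto_const filterlim_compose[OF _ rlim])
      show "AE z in circle. norm (F (of_real (r j) * z) * g z * e z) \<le> M * cmod (g z)" for j
        using r[of j] by (intro AE_I2) (auto simp: norm_mult e1 intro!: mult_right_mono M)
      show "(\<lambda>z. F (of_real (r j) * z) * g z * e z) \<in> borel_measurable circle" for j
        using dilm[OF r[of j]] by measurable
    qed measurable
    then have "(LINT z|circle. \<theta> z * g z * e z) = 0"
      by (simp add: dil[OF r] LIMSEQ_const_iff)
    then show ?thesis
      by (simp add: fourier_coeff_def ip_def e_def del: complex_cnj_power_int)
  qed
  then show ?thesis
    using Linf_mult_L2[OF inner_function_Linf[OF inner] gL] by (simp add: H2_def)
qed

section \<open>The model space and its complement\<close>

lemma K_iff: "k \<in> K \<theta> \<longleftrightarrow> k \<in> H2 \<and> (\<forall>g\<in>H2. ip k (\<lambda>z. \<theta> z * g z) = 0)"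
  unfolding K_def ominus_def by blast

lemma Kperp_iff: "h \<in> Kperp \<theta> \<longleftrightarrow> h \<in> L2 \<and> (\<forall>k\<in>K \<theta>. ip h k = 0)"
  by (simp add: Kperp_def ominus_def)

lemma K_H2: "k \<in> K \<theta> \<Longrightarrow> k \<in> H2"
  by (simp add: K_iff)

lemma K_L2: "k \<in> K \<theta> \<Longrightarrow> k \<in> L2"
  by (intro H2_L2 K_H2)

lemma Kperp_L2: "h \<in> Kperp \<theta> \<Longrightarrow> h \<in> L2"
  by (simp add: Kperp_iff)

lemma ip_K_Kperp:
  assumes "k \<in> K \<theta>" "h \<in> Kperp \<theta>"
  shows "ip k h = 0" "ip h k = 0"
  using assms ip_cnj[of h k] by (auto simp: Kperp_iff)

lemma Kperp_diff: "f \<in> Kperp \<theta> \<Longrightarrow> g \<in> Kperp \<theta> \<Longrightarrow> (\<lambda>z. f z - g z) \<in> Kperp \<theta>"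
  by (auto simp: Kperp_iff L2_diff ip_diff_left K_L2)

lemma Kperp_scale: "f \<in> Kperp \<theta> \<Longrightarrow> (\<lambda>z. c * f z) \<in> Kperp \<theta>"
  by (auto simp: Kperp_iff L2_scale ip_scale_left)

text \<open>
  Almost everywhere identities in \<open>Kperp\<close> are proved by testing against \<open>Kperp\<close>: the difference of the two sides
  is itself a test function, orthogonal to itself.
\<close>

lemma Kperp_eqI:
  assumes f: "f \<in> Kperp \<theta>" and g: "g \<in> Kperp \<theta>"
    and eq: "\<And>k. k \<in> Kperp \<theta> \<Longrightarrow> ip f k = ip g k"
  shows "f \<doteq> g"
proof -
  have d: "(\<lambda>z. f z - g z) \<in> Kperp \<theta>" by (intro Kperp_diff f g)
  have "ip (\<lambda>z. f z - g z) (\<lambda>z. f z - g z) = 0"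
    using eq[OF d] f g d by (simp add: ip_diff_left Kperp_L2)
  from ip_self_eq_0_AE[OF Kperp_L2[OF d] this] show ?thesis by simp
qed

lemma z_mult_L2: "f \<in> L2 \<Longrightarrow> (\<lambda>z. z * f z) \<in> L2"
  by (intro Linf_mult_L2 Linf_id)

lemma cnj_mult_L2: "f \<in> L2 \<Longrightarrow> (\<lambda>z. cnj z * f z) \<in> L2"
  by (intro Linf_mult_L2 Linf_cnj Linf_id)

context
  fixes \<theta> :: "complex \<Rightarrow> complex"
  assumes inner: "inner_function \<theta>"
begin

lemma theta_Linf: "\<theta> \<in> Linf"
  by (rule inner_function_Linf[OF inner])

lemma theta_mult_H2: "g \<in> H2 \<Longrightarrow> (\<lambda>z. \<theta> z * g z) \<in> H2"
  by (rule inner_function_mult_H2[OF inner])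

lemma theta_in_H2: "\<theta> \<in> H2"
  using theta_mult_H2[OF H2_const[of 1]] by simp

lemma theta_mult_L2: "f \<in> L2 \<Longrightarrow> (\<lambda>z. \<theta> z * f z) \<in> L2"
  by (intro Linf_mult_L2 theta_Linf)

lemma ip_theta_mult:
  assumes "f \<in> L2" "g \<in> L2"
  shows "ip (\<lambda>z. \<theta> z * f z) (\<lambda>z. \<theta> z * g z) = ip f g"
  unfolding ip_def
proof (rule integral_cong_AE)
  have "AE z in circle. cmod (\<theta> z) = 1"
    using inner by (simp add: inner_function_def)
  then show "AE z in circle. \<theta> z * f z * cnj (\<theta> z * g z) = f z * cnj (g z)"
  proof eventually_elim
    case (elim z)
    then have "\<theta> z * cnj (\<theta> z) = 1" by (simp flip: complex_norm_square)
    then show ?case by (simp add: algebra_simps)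
  qed
qed (use assms theta_Linf in measurable)

lemma theta_mult_H2_Kperp:
  assumes "g \<in> H2"
  shows "(\<lambda>z. \<theta> z * g z) \<in> Kperp \<theta>"
  unfolding Kperp_iff
proof (intro conjI ballI)
  fix k assume "k \<in> K \<theta>"
  then have "ip k (\<lambda>z. \<theta> z * g z) = 0"
    using assms by (simp add: K_iff)
  then show "ip (\<lambda>z. \<theta> z * g z) k = 0"
    using ip_cnj[of k] by (metis complex_cnj_zero)
qed (intro theta_mult_L2 H2_L2 assms)

lemma theta_in_Kperp: "\<theta> \<in> Kperp \<theta>"
  using theta_mult_H2_Kperp[OF H2_const[of 1]] by simp

text \<open>
  This identifies \<open>Qt\<close>, which is given by a formula, as the orthogonal projection onto \<open>Kperp\<close>: the
  complementary part is \<open>P f - \<theta> P (cnj \<theta> f)\<close>.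
\<close>

lemma Qt_decomp:
  assumes f: "f \<in> L2"
  shows "(\<lambda>z. f z - Qt \<theta> f z) \<in> K \<theta>" and "Qt \<theta> f \<in> Kperp \<theta>"
proof -
  let ?g = "\<lambda>z. cnj (\<theta> z) * f z"
  have g: "?g \<in> L2" by (intro Linf_mult_L2 Linf_cnj theta_Linf f)
  have Pf: "P f \<in> H2" "P f \<in> L2" using P_H2[OF f] H2_L2 by auto
  have Pg: "P ?g \<in> H2" "P ?g \<in> L2" using P_H2[OF g] H2_L2 by auto
  have tPg: "(\<lambda>z. \<theta> z * P ?g z) \<in> H2" by (rule theta_mult_H2[OF Pg(1)])
  have R: "(\<lambda>z. f z - Qt \<theta> f z) = (\<lambda>z. P f z - \<theta> z * P ?g z)"
    by (simp add: Qt_def Q_def fun_eq_iff)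
  show "(\<lambda>z. f z - Qt \<theta> f z) \<in> K \<theta>"
    unfolding R K_iff
  proof (intro conjI ballI)
    fix h assume h: "h \<in> H2"
    have "ip (\<lambda>z. P f z - \<theta> z * P ?g z) (\<lambda>z. \<theta> z * h z) =
        ip (P f) (\<lambda>z. \<theta> z * h z) - ip (\<lambda>z. \<theta> z * P ?g z) (\<lambda>z. \<theta> z * h z)"
      by (intro ip_diff_left Pf H2_L2 tPg theta_mult_H2 h)
    also have "\<dots> = ip f (\<lambda>z. \<theta> z * h z) - ip ?g h"
      using f g h by (simp add: ip_P theta_mult_H2 ip_theta_mult Pg H2_L2)
    also have "\<dots> = 0" by (simp add: ip_mult_left)
    finally show "ip (\<lambda>z. P f z - \<theta> z * P ?g z) (\<lambda>z. \<theta> z * h z) = 0" .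
  qed (intro H2_diff Pf tPg)
  have Qeq: "Qt \<theta> f = (\<lambda>z. (f z - P f z) + \<theta> z * P ?g z)"
    by (simp add: Qt_def Q_def fun_eq_iff)
  show "Qt \<theta> f \<in> Kperp \<theta>"
    unfolding Qeq Kperp_iff
  proof (intro conjI ballI)
    fix k assume k: "k \<in> K \<theta>"
    then show "ip (\<lambda>z. (f z - P f z) + \<theta> z * P ?g z) k = 0"
      using ip_P[OF f K_H2[OF k]] ip_K_Kperp(2)[OF k theta_mult_H2_Kperp[OF Pg(1)]]
      by (simp add: ip_add_left ip_diff_left L2_diff f Pf theta_mult_L2 Pg K_L2)
  qed (intro L2_add L2_diff f Pf theta_mult_L2 Pg)
qed

lemma Qt_L2: "f \<in> L2 \<Longrightarrow> Qt \<theta> f \<in> L2"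
  by (rule Kperp_L2[OF Qt_decomp(2)])

lemma ip_Qt:
  assumes "f \<in> L2" "k \<in> Kperp \<theta>"
  shows "ip (Qt \<theta> f) k = ip f k" "ip k (Qt \<theta> f) = ip k f"
proof -
  have "ip (\<lambda>z. f z - Qt \<theta> f z) k = 0"
    by (rule ip_K_Kperp(1)[OF Qt_decomp(1)[OF assms(1)] assms(2)])
  then show "ip (Qt \<theta> f) k = ip f k"
    using assms by (simp add: ip_diff_left Qt_L2 Kperp_L2)
  then show "ip k (Qt \<theta> f) = ip k f"
    using ip_cnj[of f k] ip_cnj[of "Qt \<theta> f" k] by simp
qed

lemma Qt_eqI:
  assumes "f \<in> L2" "q \<in> Kperp \<theta>" "\<And>k. k \<in> Kperp \<theta> \<Longrightarrow> ip f k = ip q k"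
  shows "Qt \<theta> f \<doteq> q"
  by (rule Kperp_eqI[OF Qt_decomp(2)]) (use assms in \<open>auto simp: ip_Qt\<close>)

lemma Qt_diff_scale:
  assumes u: "u \<in> L2" and f: "f \<in> L2" and g: "g \<in> L2" and ueq: "u \<doteq> (\<lambda>z. f z - c * g z)"
  shows "Qt \<theta> u \<doteq> (\<lambda>z. Qt \<theta> f z - c * Qt \<theta> g z)"
proof (rule Qt_eqI[OF u])
  fix k assume k: "k \<in> Kperp \<theta>"
  have "ip u k = ip (\<lambda>z. f z - c * g z) k"
    by (intro ip_cong_AE L2_measurable L2_diff L2_scale Kperp_L2[OF k] u f g ueq)
  then show "ip u k = ip (\<lambda>z. Qt \<theta> f z - c * Qt \<theta> g z) k"
    using f g k by (simp add: ip_diff_left ip_scale_left L2_scale Qt_L2 Kperp_L2 ip_Qt)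
qed (intro Kperp_diff Kperp_scale Qt_decomp f g)

section \<open>The compressed shift and its adjoint\<close>

text \<open>
  The functions \<open>\<theta> * g\<close> and \<open>g\<close> of \<open>H2\<close> are orthogonal to \<open>cnj\<close>, and multiplication by \<open>\<theta>\<close> is
  isometric; so the inner products of both \<open>cnj z * \<theta> z\<close> and \<open>cnj z\<close> with \<open>\<theta> * g\<close> vanish.
\<close>

lemma backward_shift_theta_K: "backward_shift \<theta> \<in> K \<theta>"
  unfolding K_iff
proof (intro conjI ballI)
  show "backward_shift \<theta> \<in> H2" by (rule H2_backward_shift[OF theta_in_H2])
  fix g assume g: "g \<in> H2"
  have cL: "(\<lambda>z. cnj z * \<theta> z) \<in> L2" by (intro cnj_mult_L2 H2_L2 theta_in_H2)
  have "ip cnj (\<lambda>z. \<theta> z * g z) = 0"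
    using H2_coeff[OF theta_mult_H2[OF g], of "-1"] ip_cnj[of "\<lambda>z. \<theta> z * g z" cnj]
    by (simp add: ip_cnj_id)
  moreover have "ip cnj g = 0"
    using H2_coeff[OF g, of "-1"] ip_cnj[of g cnj] by (simp add: ip_cnj_id)
  moreover have "ip (\<lambda>z. cnj z * \<theta> z) (\<lambda>z. \<theta> z * g z) = ip cnj g"
    using ip_theta_mult[OF cnj_L2 H2_L2[OF g]] by (simp add: mult.commute)
  moreover have "backward_shift \<theta> = (\<lambda>z. cnj z * \<theta> z - fourier_coeff \<theta> 0 * cnj z)"
    by (simp add: backward_shift_def fun_eq_iff algebra_simps)
  ultimately show "ip (backward_shift \<theta>) (\<lambda>z. \<theta> z * g z) = 0"
    by (simp add: ip_diff_left ip_scale_left cL L2_scale cnj_L2 H2_L2 theta_mult_H2 g)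
qed

lemma backward_shift_theta_L2: "backward_shift \<theta> \<in> L2" by (rule K_L2[OF backward_shift_theta_K])

text \<open>
  The shift maps \<open>K \<theta>\<close> into \<open>K \<theta>\<close> plus the multiples of \<open>\<theta>\<close>. Moved to the other side of the inner
  product, the shift turns \<open>\<theta> * g\<close> into \<open>cnj z * \<theta> z * g z\<close>. Splitting off the constant terms of \<open>g\<close> and
  then of \<open>\<theta>\<close> writes this as an element of \<open>\<theta> H2\<close>, a multiple of the backward shift of \<open>\<theta>\<close>, and a
  multiple of \<open>cnj z\<close>; the first and the last are orthogonal to \<open>K \<theta>\<close>.
\<close>

lemma shift_K:
  assumes k: "k \<in> K \<theta>"
  shows "(\<lambda>z. z * k z - ip k (backward_shift \<theta>) * \<theta> z) \<in> K \<theta>"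
  unfolding K_iff
proof (intro conjI ballI)
  show "(\<lambda>z. z * k z - ip k (backward_shift \<theta>) * \<theta> z) \<in> H2"
    by (intro H2_diff H2_scale H2_shift theta_in_H2 K_H2[OF k])
  fix g assume g: "g \<in> H2"
  let ?B = "backward_shift g"
  have B: "?B \<in> H2" by (rule H2_backward_shift[OF g])
  have "ip (\<lambda>z. z * k z) (\<lambda>z. \<theta> z * g z) = ip k (\<lambda>z. cnj z * (\<theta> z * g z))"
    by (rule ip_mult_left)
  also have "(\<lambda>z. cnj z * (\<theta> z * g z)) = (\<lambda>z. (\<theta> z * ?B z + fourier_coeff g 0 * backward_shift \<theta> z)
      + (fourier_coeff g 0 * fourier_coeff \<theta> 0) * cnj z)"
    by (simp add: backward_shift_def fun_eq_iff algebra_simps)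
  also have "ip k \<dots> = (ip k (\<lambda>z. \<theta> z * ?B z) + ip k (\<lambda>z. fourier_coeff g 0 * backward_shift \<theta> z))
      + ip k (\<lambda>z. (fourier_coeff g 0 * fourier_coeff \<theta> 0) * cnj z)"
    by (subst ip_add_right, intro L2_add theta_mult_L2 H2_L2[OF B] L2_scale backward_shift_theta_L2,
        intro L2_scale cnj_L2, rule K_L2[OF k], subst ip_add_right,
        intro theta_mult_L2 H2_L2[OF B], intro L2_scale backward_shift_theta_L2, rule K_L2[OF k], rule refl)
  also have "ip k (\<lambda>z. \<theta> z * ?B z) = 0"
    using k B by (simp only: K_iff)
  also have "ip k (\<lambda>z. (fourier_coeff g 0 * fourier_coeff \<theta> 0) * cnj z) = 0"
    unfolding ip_scale_right using H2_coeff[OF K_H2[OF k], of "-1"] by (simp add: ip_cnj_id)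
  finally have 1: "ip (\<lambda>z. z * k z) (\<lambda>z. \<theta> z * g z) = cnj (fourier_coeff g 0) * ip k (backward_shift \<theta>)"
    by (simp add: ip_scale_right)
  have "ip \<theta> (\<lambda>z. \<theta> z * g z) = cnj (fourier_coeff g 0)"
    using ip_theta_mult[OF const_L2[of 1] H2_L2[OF g]] by (simp add: fourier_coeff_0 ip_cnj)
  with 1 show "ip (\<lambda>z. z * k z - ip k (backward_shift \<theta>) * \<theta> z) (\<lambda>z. \<theta> z * g z) = 0"
    by (simp add: ip_diff_left ip_scale_left z_mult_L2 K_L2[OF k] L2_scale H2_L2 theta_in_H2 theta_mult_L2 g)
qed

lemma ip_shift_K:
  assumes k: "k \<in> K \<theta>" and h: "h \<in> Kperp \<theta>"
  shows "ip (\<lambda>z. z * k z) h = ip k (backward_shift \<theta>) * ip \<theta> h"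
  using ip_K_Kperp(1)[OF shift_K[OF k] h]
  by (simp add: ip_diff_left ip_scale_left z_mult_L2 K_L2[OF k] L2_scale H2_L2 theta_in_H2 Kperp_L2[OF h])

lemma Qt_shift_K:
  assumes k: "k \<in> K \<theta>"
  shows "Qt \<theta> (\<lambda>z. z * k z) \<doteq> (\<lambda>z. ip k (backward_shift \<theta>) * \<theta> z)"
  by (rule Qt_eqI)
     (simp_all add: z_mult_L2 K_L2[OF k] Kperp_scale theta_in_Kperp ip_shift_K[OF k] ip_scale_left)

text \<open>
  Dual to the preceding lemma: the component of \<open>cnj z * h z\<close> in \<open>K \<theta>\<close> is determined by its inner products
  with \<open>k\<close> in \<open>K \<theta>\<close>, that is by those of \<open>h\<close> with \<open>z * k z\<close>. The explicit function serves both as the witness that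
  makes the choice in \<open>adjoint_on\<close> meaningful and, by uniqueness, as its value.
\<close>

lemma adjoint_U:
  assumes h: "h \<in> Kperp \<theta>"
  shows "adjoint_on (Kperp \<theta>) (U \<theta>) h \<in> Kperp \<theta>"
    and "adjoint_on (Kperp \<theta>) (U \<theta>) h \<doteq> (\<lambda>z. cnj z * h z - ip h \<theta> * backward_shift \<theta> z)"
proof -
  let ?A = "adjoint_on (Kperp \<theta>) (U \<theta>) h"
  let ?q = "\<lambda>z. cnj z * h z - ip h \<theta> * backward_shift \<theta> z"
  have hL: "h \<in> L2" by (rule Kperp_L2[OF h])
  have ipU: "ip (U \<theta> k) h = ip k (\<lambda>z. cnj z * h z)" if "k \<in> Kperp \<theta>" for k
    using that by (simp add: U_def ip_Qt h z_mult_L2 Kperp_L2 ip_mult_left)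
  have q: "?q \<in> Kperp \<theta>"
    unfolding Kperp_iff
  proof (intro conjI ballI)
    fix k assume k: "k \<in> K \<theta>"
    have "ip (\<lambda>z. cnj z * h z) k = ip h (\<lambda>z. z * k z)"
      using ip_mult_left[of cnj h k] by simp
    also have "\<dots> = cnj (ip (\<lambda>z. z * k z) h)" by (simp add: ip_cnj)
    also have "\<dots> = ip (backward_shift \<theta>) k * ip h \<theta>" by (simp add: ip_shift_K[OF k h] ip_cnj)
    finally show "ip ?q k = 0"
      by (simp add: ip_diff_left ip_scale_left cnj_mult_L2 hL L2_scale backward_shift_theta_L2 K_L2[OF k])
  qed (intro L2_diff cnj_mult_L2 hL L2_scale backward_shift_theta_L2)
  have ipq: "ip k ?q = ip k (\<lambda>z. cnj z * h z)" if "k \<in> Kperp \<theta>" for k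
    using that ip_K_Kperp(2)[OF backward_shift_theta_K that]
    by (simp add: ip_diff_right ip_scale_right cnj_mult_L2 hL L2_scale backward_shift_theta_L2 Kperp_L2)
  have "\<exists>g. g \<in> Kperp \<theta> \<and> (\<forall>k\<in>Kperp \<theta>. ip (U \<theta> k) h = ip k g)"
    using q ipq ipU by metis
  from someI_ex[OF this] have A: "?A \<in> Kperp \<theta>" "\<And>k. k \<in> Kperp \<theta> \<Longrightarrow> ip (U \<theta> k) h = ip k ?A"
    unfolding adjoint_on_def by blast+
  show "?A \<in> Kperp \<theta>" by (rule A(1))
  show "?A \<doteq> ?q"
  proof (rule Kperp_eqI[OF A(1) q])
    fix k assume "k \<in> Kperp \<theta>"
    then have "ip k ?A = ip k ?q" using A(2) ipU ipq by simp
    then show "ip ?A k = ip ?q k" using ip_cnj by metis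
  qed
qed

end

section \<open>The commutation relation\<close>

theorem theorem2p7:
  fixes \<theta> \<phi> :: "complex \<Rightarrow> complex"
  assumes "inner_function \<theta>" and "\<phi> \<in> Linf"
  shows "\<forall>h\<in>Kperp \<theta>. AE z in circle.
    ((dual_hankel \<theta> \<phi> \<circ> adjoint_on (Kperp \<theta>) (U \<theta>)) - (U \<theta> \<circ> dual_hankel \<theta> \<phi>)) h z
    = ((\<theta> \<otimes>\<^sub>r Qt \<theta> (J (\<alpha> \<theta> (star \<phi>)))) - (Qt \<theta> (J (\<alpha> \<theta> \<phi>)) \<otimes>\<^sub>r \<theta>)) h z"
proof
  fix h assume h: "h \<in> Kperp \<theta>"
  note inn = assms(1)
  let ?w = "backward_shift \<theta>" and ?c = "ip h \<theta>"
  let ?A = "adjoint_on (Kperp \<theta>) (U \<theta>) h"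
  define f where "f = J (\<lambda>z. \<phi> z * h z)"
  define R where "R = (\<lambda>z. f z - Qt \<theta> f z)"
  have hL: "h \<in> L2" by (rule Kperp_L2[OF h])
  have wL: "?w \<in> L2" by (rule backward_shift_theta_L2[OF inn])
  have f: "f \<in> L2" unfolding f_def by (intro L2_J Linf_mult_L2 assms hL)
  have R: "R \<in> K \<theta>" unfolding R_def by (rule Qt_decomp(1)[OF inn f])
  have \<alpha>_backward_shift: "\<alpha> \<theta> \<psi> = (\<lambda>z. \<psi> z * ?w z)" for \<psi>
    by (simp add: \<alpha>_def backward_shift_def fun_eq_iff)
  have \<alpha>L: "J (\<alpha> \<theta> \<psi>) \<in> L2" if "\<psi> \<in> Linf" for \<psi>
    unfolding \<alpha>_backward_shift by (intro L2_J Linf_mult_L2 that wL)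

  \<comment> \<open>The flip turns multiplication by \<open>cnj z\<close> into multiplication by \<open>z\<close>; this is what makes the leading
    terms of the two compositions equal.\<close>
  have "J (\<lambda>z. \<phi> z * ?A z) \<doteq> (\<lambda>z. z * f z - ?c * J (\<alpha> \<theta> \<phi>) z)"
    using AE_circle_cnj[OF adjoint_U(2)[OF inn h]]
  proof eventually_elim
    case (elim z)
    then show ?case
      by (simp only: J_def f_def \<alpha>_backward_shift complex_cnj_cnj) (simp add: algebra_simps)
  qed
  then have HA: "dual_hankel \<theta> \<phi> ?A \<doteq> (\<lambda>z. Qt \<theta> (\<lambda>z. z * f z) z - ?c * Qt \<theta> (J (\<alpha> \<theta> \<phi>)) z)"
    unfolding dual_hankel_def
    by (intro Qt_diff_scale[OF inn] L2_J Linf_mult_L2 assms Kperp_L2[OF adjoint_U(1)[OF inn h]]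
        z_mult_L2 f \<alpha>L)

  have UH: "U \<theta> (dual_hankel \<theta> \<phi> h) \<doteq> (\<lambda>z. Qt \<theta> (\<lambda>z. z * f z) z - 1 * Qt \<theta> (\<lambda>z. z * R z) z)"
    unfolding U_def dual_hankel_def f_def[symmetric]
    by (intro Qt_diff_scale[OF inn] z_mult_L2 Qt_L2[OF inn] f K_L2[OF R])
       (simp add: R_def algebra_simps)

  \<comment> \<open>Both projections in the coefficient are absorbed: first \<open>R\<close> is replaced by \<open>f\<close> because \<open>?w\<close> is in \<open>K \<theta>\<close>,
    and at the end \<open>Qt\<close> is inserted because \<open>h\<close> is in \<open>Kperp \<theta>\<close>.\<close>
  have "ip R ?w = ip f ?w"
    using ip_K_Kperp(2)[OF backward_shift_theta_K[OF inn] Qt_decomp(2)[OF inn f]]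
    by (simp add: R_def ip_diff_left f Qt_L2[OF inn] wL)
  also have "\<dots> = ip (\<lambda>z. \<phi> z * h z) (J ?w)"
    unfolding f_def by (intro ip_J Linf_mult_L2 assms hL wL)
  also have "\<dots> = ip h (J (\<alpha> \<theta> (star \<phi>)))"
    by (simp add: ip_mult_left \<alpha>_backward_shift J_def star_def)
  also have "\<dots> = ip h (Qt \<theta> (J (\<alpha> \<theta> (star \<phi>))))"
    by (intro ip_Qt(2)[OF inn, symmetric] \<alpha>L Linf_star assms h)
  finally have coeff: "ip R ?w = ip h (Qt \<theta> (J (\<alpha> \<theta> (star \<phi>))))" .

  show "AE z in circle.
    ((dual_hankel \<theta> \<phi> \<circ> adjoint_on (Kperp \<theta>) (U \<theta>)) - (U \<theta> \<circ> dual_hankel \<theta> \<phi>)) h z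
    = ((\<theta> \<otimes>\<^sub>r Qt \<theta> (J (\<alpha> \<theta> (star \<phi>)))) - (Qt \<theta> (J (\<alpha> \<theta> \<phi>)) \<otimes>\<^sub>r \<theta>)) h z"
    using HA UH Qt_shift_K[OF inn R]
    by eventually_elim (simp add: rank_one_def coeff)
qed

end
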